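(* Assume the data conditions (i)–(ii) listed in the context, and let $(u_h^n)_{0\le n\le N}\subset V_h$ be a solution of the fully discrete scheme described in the context (with $u_h^0=P_h\varphi$). Then for every $n\in\{1,\dots,N\}$ $$\|u_h^n\|\le C\left(\|u_h^0\|+F\right),$$ where the positive constant $C=C(\alpha,T,\Omega)$ does not depend on the numerical grid (on $h$, $\Delta t$, $n$).
   Context: Let $\alpha\in(0,1)$, $T>0$, and let $\Omega\subset\mathbb{R}^d$ be a bounded domain. Let $(\cdot,\cdot)$ and $\|\cdot\|$ be the inner product and norm of $L^2(\Omega)$. The scheme approximates the semilinear subdiffusion problem $\partial_t^\alpha u=\nabla\cdot(D(x,t)\nabla u)+f(x,t,u)$ in $\Omega\times(0,T]$, $u=0$ on $\partial\Omega$, $u(x,0)=\varphi(x)$, where $\varphi\in H^p_0$ with $p\in(0,2]$, $H^p_0$ is the (fractional) Sobolev space of functions on $\Omega$ with vanishing trace, and $\partial_t^\alpha$ is the Caputo derivative. Data conditions: (i) there are constants $F,L>0$ with $|f(x,t,u)|\le F$ and $|f(x,t,u)-f(x,t,v)|\le L|u-v|$ for all $x,t,u,v$; (ii) there are constants $D_\pm$ with $0<D_-\le D(x,t)\le D_+$; $|\partial_t D(x,t)|\le\kappa(t)$ for some $\kappa\in L^1((0,T))$; and $\nabla D(\cdot,t)\in L^2(\Omega)$. Notation: $D(t)=D(\cdot,t)$, $f(t,u)=f(\cdot,t,u)$, and $a(w;u,v)=\int_\Omega w\,\nabla u\cdot\nabla v\,dx$. Space discretization: $V_h\subset H_0^1$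 is the finite-dimensional space of continuous piecewise linear functions over a quasiuniform triangulation $\Omega_h\subset\overline\Omega$ of $\Omega$ with maximal diameter $h$; $P_h$ is the orthogonal projection onto $V_h$. Time discretization: $t_n=n\Delta t$, $\Delta t=T/N$, and the L1 discretization of the Caputo derivative is $$\delta_t^\alpha y(t_n)=\frac{(\Delta t)^{-\alpha}}{\Gamma(2-\alpha)}\sum_{i=0}^{n-1}b_{n-i}(1-\alpha)\,(y(t_{i+1})-y(t_i)),\qquad b_j(\beta)=j^\beta-(j-1)^\beta,$$ and for a sequence $(y^n)$ the same formula is used with $y^i$ in place of $y(t_i)$. Fully discrete scheme: $u_h^0=P_h\varphi$; for $n\ge2$, $u_h^n\in V_h$ satisfies $$(\delta_t^\alpha u_h^n,v_h)+a(D(t_n);u_h^n,v_h)=(f(t_n,\hat u_h^n),v_h)\quad\text{for all }v_h\in V_h,\qquad \hat u_h^n=2u_h^{n-1}-u_h^{n-2};$$ for $n=1$, $u_h^1\in V_h$ satisfies the same equation with $\hat u_h^1$ replaced by $u_h^1$. *)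

theory Defs
  imports "HOL-Analysis.Analysis"
begin

section \<open>The space $L^2(\Omega)$\<close>

text \<open>Functions on \<open>\<Omega>\<close> are represented by total functions on the ambient Euclidean space, of
  which only the values on \<open>\<Omega>\<close> matter; \<^term>\<open>L2 \<Omega>\<close> consists of representatives, not of
  classes modulo null sets.\<close>

definition L2 :: "'a::euclidean_space set \<Rightarrow> ('a \<Rightarrow> 'b::euclidean_space) set" where
  "L2 \<Omega> = {u. u \<in> borel_measurable (lebesgue_on \<Omega>) \<and>
              integrable (lebesgue_on \<Omega>) (\<lambda>x. (norm (u x))\<^sup>2)}"

definition L2_inner :: "'a::euclidean_space set \<Rightarrow> ('a \<Rightarrow> real) \<Rightarrow> ('a \<Rightarrow> real) \<Rightarrow> real" where
  "L2_inner \<Omega> u v = (\<integral>x. u x * v x \<partial>lebesgue_on \<Omega>)"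

definition L2_norm :: "'a::euclidean_space set \<Rightarrow> ('a \<Rightarrow> real) \<Rightarrow> real" where
  "L2_norm \<Omega> u = sqrt (L2_inner \<Omega> u u)"

definition L2_norm_sq :: "'a::euclidean_space set \<Rightarrow> ('a \<Rightarrow> 'b::euclidean_space) \<Rightarrow> ennreal" where
  "L2_norm_sq \<Omega> u = (\<integral>\<^sup>+x. ennreal ((norm (u x))\<^sup>2) \<partial>lebesgue_on \<Omega>)"

definition L2_projection ::
    "'a::euclidean_space set \<Rightarrow> ('a \<Rightarrow> real) set \<Rightarrow> ('a \<Rightarrow> real) \<Rightarrow> ('a \<Rightarrow> real) \<Rightarrow> bool" where
  "L2_projection \<Omega> V \<phi> w \<longleftrightarrow> w \<in> V \<and> (\<forall>v\<in>V. L2_inner \<Omega> (\<lambda>x. \<phi> x - w x) v = 0)"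

section \<open>Weak gradients\<close>

definition gradient :: "('a::euclidean_space \<Rightarrow> real) \<Rightarrow> 'a \<Rightarrow> 'a" where
  "gradient f x = (THE g. GDERIV f x :> g)"

primrec C_k :: "nat \<Rightarrow> ('a::euclidean_space \<Rightarrow> real) \<Rightarrow> bool" where
  "C_k 0 f \<longleftrightarrow> continuous_on UNIV f"
| "C_k (Suc k) f \<longleftrightarrow> (\<exists>g. (\<forall>x. GDERIV f x :> g x) \<and> (\<forall>b\<in>Basis. C_k k (\<lambda>x. g x \<bullet> b)))"

text \<open>The space $C_c^\infty(\Omega)$, extended by zero.\<close>

definition test_functions :: "'a::euclidean_space set \<Rightarrow> ('a \<Rightarrow> real) set" where
  "test_functions \<Omega> =
     {\<psi>. (\<forall>k. C_k k \<psi>) \<and> (\<exists>K. compact K \<and> K \<subseteq> \<Omega> \<and> (\<forall>x. x \<notin> K \<longrightarrow> \<psi> x = 0))}"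

definition locally_integrable ::
    "'a::euclidean_space set \<Rightarrow> ('a \<Rightarrow> 'b::euclidean_space) \<Rightarrow> bool" where
  "locally_integrable \<Omega> u \<longleftrightarrow> (\<forall>K. compact K \<and> K \<subseteq> \<Omega> \<longrightarrow> u absolutely_integrable_on K)"

definition has_weak_gradient ::
    "'a::euclidean_space set \<Rightarrow> ('a \<Rightarrow> real) \<Rightarrow> ('a \<Rightarrow> 'a) \<Rightarrow> bool" where
  "has_weak_gradient \<Omega> u G \<longleftrightarrow>
     locally_integrable \<Omega> u \<and> locally_integrable \<Omega> G \<and>
     (\<forall>\<psi>\<in>test_functions \<Omega>.
        (\<integral>x. u x *\<^sub>R gradient \<psi> x \<partial>lebesgue_on \<Omega>) = - (\<integral>x. \<psi> x *\<^sub>R G x \<partial>lebesgue_on \<Omega>))"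

text \<open>Weak gradients on an open set are unique up to null sets, so the choice of the
  representative does not affect integrals.\<close>

definition weak_gradient :: "'a::euclidean_space set \<Rightarrow> ('a \<Rightarrow> real) \<Rightarrow> 'a \<Rightarrow> 'a" where
  "weak_gradient \<Omega> u = (SOME G. has_weak_gradient \<Omega> u G)"

section \<open>Sobolev spaces\<close>

text \<open>The squared Gagliardo seminorm, for $0 < s < 1$.\<close>

definition gagliardo_sq :: "real \<Rightarrow> 'a::euclidean_space set \<Rightarrow> ('a \<Rightarrow> real) \<Rightarrow> ennreal" where
  "gagliardo_sq s \<Omega> u =
     (\<integral>\<^sup>+x. (\<integral>\<^sup>+y. ennreal ((u x - u y)\<^sup>2 / norm (x - y) powr (real DIM('a) + 2 * s))
        \<partial>lebesgue_on \<Omega>) \<partial>lebesgue_on \<Omega>)"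

text \<open>\<^term>\<open>sobolev_aux s k \<Omega>\<close> is the Sobolev--Slobodeckij space $H^{k+s}(\Omega)$, for $0 \le s < 1$.\<close>

primrec sobolev_aux :: "real \<Rightarrow> nat \<Rightarrow> 'a::euclidean_space set \<Rightarrow> ('a \<Rightarrow> real) set" where
  "sobolev_aux s 0 \<Omega> = {u \<in> L2 \<Omega>. s > 0 \<longrightarrow> gagliardo_sq s \<Omega> u < \<infinity>}"
| "sobolev_aux s (Suc k) \<Omega> =
     {u \<in> L2 \<Omega>. \<exists>G. has_weak_gradient \<Omega> u G \<and> (\<forall>b\<in>Basis. (\<lambda>x. G x \<bullet> b) \<in> sobolev_aux s k \<Omega>)}"

definition sobolev :: "real \<Rightarrow> 'a::euclidean_space set \<Rightarrow> ('a \<Rightarrow> real) set" where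
  "sobolev p \<Omega> = sobolev_aux (frac p) (nat \<lfloor>p\<rfloor>) \<Omega>"

text \<open>$H^1_0(\Omega)$: the closure of $C_c^\infty(\Omega)$ in $H^1(\Omega)$.\<close>

definition sobolev1_zero :: "'a::euclidean_space set \<Rightarrow> ('a \<Rightarrow> real) set" where
  "sobolev1_zero \<Omega> =
     {u \<in> sobolev 1 \<Omega>. \<exists>\<psi>. (\<forall>k. \<psi> k \<in> test_functions \<Omega>) \<and>
        (\<lambda>k::nat. L2_norm_sq \<Omega> (\<lambda>x. u x - \<psi> k x) +
             L2_norm_sq \<Omega> (\<lambda>x. weak_gradient \<Omega> u x - gradient (\<psi> k) x)) \<longlonglongrightarrow> 0}"

text \<open>$H^p_0(\Omega)$ for $p > 0$. For $p < 1$ this is the closure of $C_c^\infty(\Omega)$ in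
  $H^p(\Omega)$; for $p \ge 1$ only the trace of the function itself, and not that of its gradient,
  is required to vanish, that is, $H^p_0 = H^p \cap H^1_0$.\<close>

definition sobolev_zero :: "real \<Rightarrow> 'a::euclidean_space set \<Rightarrow> ('a \<Rightarrow> real) set" where
  "sobolev_zero p \<Omega> =
     (if p < 1
      then {u \<in> sobolev p \<Omega>. \<exists>\<psi>. (\<forall>k. \<psi> k \<in> test_functions \<Omega>) \<and>
              (\<lambda>k::nat. L2_norm_sq \<Omega> (\<lambda>x. u x - \<psi> k x) +
                   gagliardo_sq p \<Omega> (\<lambda>x. u x - \<psi> k x)) \<longlonglongrightarrow> 0}
      else sobolev p \<Omega> \<inter> sobolev1_zero \<Omega>)"

section \<open>Data conditions\<close>

definition source_condition ::
    "'a::euclidean_space set \<Rightarrow> real \<Rightarrow> real \<Rightarrow> real \<Rightarrow> ('a \<Rightarrow> real \<Rightarrow> real \<Rightarrow> real) \<Rightarrow> bool" where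
  "source_condition \<Omega> T F L f \<longleftrightarrow> 0 < F \<and> 0 < L \<and>
     (\<forall>x\<in>\<Omega>. \<forall>t\<in>{0..T}. \<forall>u. \<bar>f x t u\<bar> \<le> F) \<and>
     (\<forall>x\<in>\<Omega>. \<forall>t\<in>{0..T}. \<forall>u v. \<bar>f x t u - f x t v\<bar> \<le> L * \<bar>u - v\<bar>)"

definition diffusion_condition ::
    "'a::euclidean_space set \<Rightarrow> real \<Rightarrow> real \<Rightarrow> real \<Rightarrow> (real \<Rightarrow> real) \<Rightarrow> ('a \<Rightarrow> real \<Rightarrow> real) \<Rightarrow> bool"
  where
  "diffusion_condition \<Omega> T Dmin Dmax \<kappa> D \<longleftrightarrow> 0 < Dmin \<and>
     (\<forall>x\<in>\<Omega>. \<forall>t\<in>{0..T}. Dmin \<le> D x t \<and> D x t \<le> Dmax) \<and>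
     \<kappa> absolutely_integrable_on {0<..<T} \<and>
     (\<forall>x\<in>\<Omega>. \<forall>t\<in>{0<..<T}. (\<lambda>s. D x s) differentiable (at t) \<and>
        \<bar>deriv (\<lambda>s. D x s) t\<bar> \<le> \<kappa> t) \<and>
     (\<forall>t\<in>{0..T}. \<exists>G. has_weak_gradient \<Omega> (\<lambda>x. D x t) G \<and> G \<in> L2 \<Omega>)"

section \<open>The finite element space\<close>

text \<open>The polyhedron $\Omega_h$ is \<^term>\<open>\<Union>\<T>\<close>. Every finite mesh is quasiuniform for some \<open>\<rho>\<close>;
  the notion has content for families of meshes sharing a common \<open>\<rho>\<close>.\<close>

definition quasiuniform_triangulation ::
    "'a::euclidean_space set \<Rightarrow> real \<Rightarrow> real \<Rightarrow> 'a set set \<Rightarrow> bool" where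
  "quasiuniform_triangulation \<Omega> \<rho> h \<T> \<longleftrightarrow>
     triangulation \<T> \<and> \<T> \<noteq> {} \<and> (\<forall>K\<in>\<T>. int DIM('a) simplex K) \<and>
     \<Union>\<T> \<subseteq> closure \<Omega> \<and> h = Max (diameter ` \<T>) \<and>
     0 < \<rho> \<and> (\<forall>K\<in>\<T>. \<exists>z. cball z (\<rho> * h) \<subseteq> K)"

text \<open>Elements of $V_h$ are extended by zero outside $\Omega_h$. Continuity of the extension makes
  them vanish on the boundary of $\Omega_h$.\<close>

definition fem_space :: "'a::euclidean_space set \<Rightarrow> 'a set set \<Rightarrow> ('a \<Rightarrow> real) set" where
  "fem_space \<Omega> \<T> =
     {v \<in> sobolev1_zero \<Omega>. continuous_on UNIV v \<and> (\<forall>x. x \<notin> \<Union>\<T> \<longrightarrow> v x = 0) \<and>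
        (\<forall>K\<in>\<T>. \<exists>g c. \<forall>x\<in>K. v x = g \<bullet> x + c)}"

section \<open>The fully discrete scheme\<close>

definition b_coeff :: "nat \<Rightarrow> real \<Rightarrow> real" where
  "b_coeff j \<beta> = real j powr \<beta> - (real j - 1) powr \<beta>"

definition caputo_L1 :: "real \<Rightarrow> real \<Rightarrow> (nat \<Rightarrow> real) \<Rightarrow> nat \<Rightarrow> real" where
  "caputo_L1 \<alpha> \<tau> y n =
     \<tau> powr (-\<alpha>) / Gamma (2 - \<alpha>) *
       (\<Sum>i<n. b_coeff (n - i) (1 - \<alpha>) * (y (Suc i) - y i))"

definition diffusion_form ::
    "'a::euclidean_space set \<Rightarrow> ('a \<Rightarrow> real) \<Rightarrow> ('a \<Rightarrow> real) \<Rightarrow> ('a \<Rightarrow> real) \<Rightarrow> real" where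
  "diffusion_form \<Omega> w u v =
     (\<integral>x. w x * (weak_gradient \<Omega> u x \<bullet> weak_gradient \<Omega> v x) \<partial>lebesgue_on \<Omega>)"

definition extrapolation :: "(nat \<Rightarrow> 'a \<Rightarrow> real) \<Rightarrow> nat \<Rightarrow> 'a \<Rightarrow> real" where
  "extrapolation u n = (if n = 1 then u 1 else (\<lambda>x. 2 * u (n - 1) x - u (n - 2) x))"

definition scheme_solution ::
    "real \<Rightarrow> real \<Rightarrow> 'a::euclidean_space set \<Rightarrow> ('a \<Rightarrow> real \<Rightarrow> real) \<Rightarrow> ('a \<Rightarrow> real \<Rightarrow> real \<Rightarrow> real) \<Rightarrow>
     ('a \<Rightarrow> real) \<Rightarrow> 'a set set \<Rightarrow> nat \<Rightarrow> (nat \<Rightarrow> 'a \<Rightarrow> real) \<Rightarrow> bool" where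
  "scheme_solution \<alpha> T \<Omega> D f \<phi> \<T> N u \<longleftrightarrow>
     (let V = fem_space \<Omega> \<T>; \<tau> = T / real N; t = (\<lambda>n. real n * \<tau>) in
       (\<forall>n\<le>N. u n \<in> V) \<and>
       L2_projection \<Omega> V \<phi> (u 0) \<and>
       (\<forall>n\<in>{1..N}. \<forall>v\<in>V.
          L2_inner \<Omega> (\<lambda>x. caputo_L1 \<alpha> \<tau> (\<lambda>i. u i x) n) v +
            diffusion_form \<Omega> (\<lambda>x. D x (t n)) (u n) v =
          L2_inner \<Omega> (\<lambda>x. f x (t n) (extrapolation u n x)) v))"

end

theory Submission
  imports Defs
begin

text \<open>The stability bound is an energy estimate. Testing the scheme with \<open>u n\<close> itself makes the
  diffusion term \<open>a(D; u n, u n)\<close> nonnegative, so it can be dropped, and the boundedness of the source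
  makes the right-hand side at most \<open>F |\<Omega>|\<^bsup>1/2\<^esup> \<parallel>u n\<parallel>\<close>. Both steps are uniform in the
  mesh and in the data, which is why the constant is.

  What remains is to pass from the discrete Caputo derivative of \<open>u\<close> to that of the numbers
  \<open>y n = \<parallel>u n\<parallel>\<close>. Summation by parts expresses the discrete derivative at \<open>n\<close> as \<open>y n\<close> minus a combination
  of earlier values, with coefficients \<open>b j - b (j + 1)\<close> and \<open>b n\<close>. As \<open>x powr (1 - \<alpha>)\<close> is concave, these are
  nonnegative, so bounding each earlier \<open>(u i, u n)\<close> by \<open>y i * y n\<close> only decreases the result. This is
  \<open>L2_norm_caputo_L1_le\<close>, a consequence of the discrete maximum principle \<open>caputo_L1_nonneg_at_max\<close>,
  and it yields the scalar inequality \<open>scheme_energy_inequality\<close>, in essence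
  \<open>\<delta>\<^sup>\<alpha> y n \<le> M\<close> with \<open>M = F |\<Omega>|\<^bsup>1/2\<^esup>\<close>.

  Finally a discrete comparison argument, \<open>caputo_L1_stability\<close>, bounds a sequence with
  \<open>\<delta>\<^sup>\<alpha> y \<le> M\<close> by \<open>y 0 + c M t\<^sup>\<alpha>\<close>, just as the solution of the continuous problem grows like the
  fractional integral of a constant.\<close>

section \<open>The L1 weights\<close>

text \<open>A weight is the increment of \<open>x powr \<beta>\<close> over a unit interval, hence the derivative at some
  interior point. As the derivative decreases, its value at the common endpoint \<open>j\<close> separates the
  weights of the two adjacent intervals. This gives both the monotonicity of the weights and their
  lower bound of order \<open>j powr (\<beta> - 1)\<close>.\<close>

lemma b_coeff_bounds:
  assumes "0 < \<beta>" "\<beta> < 1" "1 \<le> j"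
  shows "b_coeff (Suc j) \<beta> \<le> \<beta> * real j powr (\<beta> - 1)"
    and "\<beta> * real j powr (\<beta> - 1) \<le> b_coeff j \<beta>"
proof -
  have increment: "\<exists>z. a < z \<and> z < a + 1 \<and> (a + 1) powr \<beta> - a powr \<beta> = \<beta> * z powr (\<beta> - 1)"
    if "0 \<le> a" for a
  proof -
    have "continuous_on {a..a + 1} (\<lambda>x. x powr \<beta>)"
      using that assms by (intro continuous_on_powr' continuous_intros) auto
    moreover have der: "((\<lambda>x. x powr \<beta>) has_real_derivative \<beta> * x powr (\<beta> - 1)) (at x)"
      if "a < x" for x
      using that \<open>0 \<le> a\<close> by (intro has_real_derivative_powr) auto
    ultimately obtain z where "a < z" "z < a + 1"
      and "(a + 1) powr \<beta> - a powr \<beta> = \<beta> * z powr (\<beta> - 1) * (a + 1 - a)"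
      using mvt[of a "a + 1" "\<lambda>x. x powr \<beta>" "\<lambda>x h. \<beta> * x powr (\<beta> - 1) * h"]
      by (auto simp: has_field_derivative_def)
    then show ?thesis
      by auto
  qed
  obtain z where "real j < z" "b_coeff (Suc j) \<beta> = \<beta> * z powr (\<beta> - 1)"
    using increment[of "real j"] by (auto simp: b_coeff_def add.commute)
  then show "b_coeff (Suc j) \<beta> \<le> \<beta> * real j powr (\<beta> - 1)"
    using assms by (simp add: powr_mono2')
  obtain z where "real j - 1 < z" "z < real j" "b_coeff j \<beta> = \<beta> * z powr (\<beta> - 1)"
    using increment[of "real j - 1"] assms by (auto simp: b_coeff_def)
  then show "\<beta> * real j powr (\<beta> - 1) \<le> b_coeff j \<beta>"
    using assms by (simp add: powr_mono2')
qed

lemma b_coeff_pos: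
  assumes "0 < \<beta>" "\<beta> < 1" "1 \<le> j"
  shows "0 < b_coeff j \<beta>"
proof -
  have "0 < \<beta> * real j powr (\<beta> - 1)"
    using assms by (intro mult_pos_pos) auto
  then show ?thesis
    using b_coeff_bounds(2)[OF assms] by linarith
qed

lemma b_coeff_antimono:
  assumes "0 < \<beta>" "\<beta> < 1" "1 \<le> i" "i \<le> j"
  shows "b_coeff j \<beta> \<le> b_coeff i \<beta>"
  using \<open>i \<le> j\<close>
proof (induction rule: dec_induct)
  case (step j)
  then show ?case
    using b_coeff_bounds[of \<beta> j] assms by linarith
qed simp

section \<open>The discrete Caputo derivative\<close>

lemma summation_by_parts:
  fixes a y :: "nat \<Rightarrow> real"
  shows "(\<Sum>i<Suc m. a i * (y (Suc i) - y i)) =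
    a m * y (Suc m) - a 0 * y 0 - (\<Sum>i<m. (a (Suc i) - a i) * y (Suc i))"
  by (induction m) (simp_all add: algebra_simps)

text \<open>The form that exposes the signs: the newest value has coefficient \<open>b 1 = 1\<close> inside the bracket,
  and all earlier values enter with nonpositive coefficients because the weights decrease.\<close>

lemma caputo_L1_by_parts:
  "caputo_L1 \<alpha> \<tau> y (Suc m) = \<tau> powr (-\<alpha>) / Gamma (2 - \<alpha>) *
    (y (Suc m) - b_coeff (Suc m) (1 - \<alpha>) * y 0 -
      (\<Sum>i<m. (b_coeff (m - i) (1 - \<alpha>) - b_coeff (Suc m - i) (1 - \<alpha>)) * y (Suc i)))"
  unfolding caputo_L1_def
  using summation_by_parts[of "\<lambda>i. b_coeff (Suc m - i) (1 - \<alpha>)" y m]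
  by (simp add: b_coeff_def)

lemma caputo_L1_diff_scale:
  "caputo_L1 \<alpha> \<tau> (\<lambda>i. g i - c * y i) n = caputo_L1 \<alpha> \<tau> g n - c * caputo_L1 \<alpha> \<tau> y n"
proof -
  have "(\<Sum>i<n. b_coeff (n - i) (1 - \<alpha>) * ((g (Suc i) - c * y (Suc i)) - (g i - c * y i))) =
    (\<Sum>i<n. b_coeff (n - i) (1 - \<alpha>) * (g (Suc i) - g i)) -
    c * (\<Sum>i<n. b_coeff (n - i) (1 - \<alpha>) * (y (Suc i) - y i))"
    by (simp add: sum_distrib_left sum_subtractf[symmetric] algebra_simps)
  then show ?thesis
    unfolding caputo_L1_def by (simp only: right_diff_distrib mult.left_commute)
qed

text \<open>A discrete maximum principle. It is the L1 counterpart of the fact that a Caputo derivative is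
  nonnegative where the function attains its maximum over the past. As the derivative ignores
  constants, the maximum can be taken to be zero; then every term of the summation by parts has
  the right sign.\<close>

lemma caputo_L1_nonneg_at_max:
  assumes "0 < \<alpha>" "\<alpha> < 1" "\<And>i. i \<le> n \<Longrightarrow> z i \<le> z n"
  shows "0 \<le> caputo_L1 \<alpha> \<tau> z n"
proof (cases n)
  case 0
  then show ?thesis by (simp add: caputo_L1_def)
next
  case (Suc m)
  define w where "w = (\<lambda>i. z i - z n)"
  have w: "w i \<le> 0" if "i \<le> n" for i
    using assms(3)[OF that] by (simp add: w_def)
  have "b_coeff (Suc m) (1 - \<alpha>) * w 0 \<le> 0"
    using assms b_coeff_pos[of "1 - \<alpha>" "Suc m"] w[of 0] by (simp add: mult_nonneg_nonpos)
  moreover have "(\<Sum>i<m. (b_coeff (m - i) (1 - \<alpha>) - b_coeff (Suc m - i) (1 - \<alpha>)) * w (Suc i)) \<le> 0"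
    using assms Suc w
    by (intro sum_nonpos mult_nonneg_nonpos) (auto intro!: b_coeff_antimono)
  moreover have "w (Suc m) = 0"
    by (simp add: w_def Suc)
  moreover have "0 \<le> \<tau> powr (-\<alpha>) / Gamma (2 - \<alpha>)"
    using assms Gamma_real_pos[of "2 - \<alpha>"] by simp
  ultimately have "0 \<le> caputo_L1 \<alpha> \<tau> w n"
    unfolding Suc caputo_L1_by_parts by (intro mult_nonneg_nonneg) auto
  then show ?thesis
    by (simp add: caputo_L1_def w_def)
qed

text \<open>Write \<open>A\<close> for \<open>\<tau>\<^sup>\<alpha> \<Gamma>(2 - \<alpha>) M\<close>. By the hypothesis, \<open>y n\<close> is at most \<open>b n * y 0 + A\<close> plus a combination
  of earlier values with nonnegative coefficients of total mass \<open>1 - b n\<close>. If the earlier values are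
  at most \<open>y 0 + A / b n\<close>, then so is \<open>y n\<close>, because the missing mass \<open>b n\<close> times \<open>A / b n\<close> is just \<open>A\<close>.
  The bound increases with \<open>n\<close> since \<open>b\<close> decreases, so the induction closes.

  The hypothesis carries the factor \<open>y k\<close> because testing with the solution produces it; it cannot
  be cancelled when \<open>y k\<close> vanishes, but then there is nothing to prove at \<open>k\<close>.\<close>

lemma caputo_L1_stability_weights:
  assumes \<alpha>: "0 < \<alpha>" "\<alpha> < 1" and "0 < \<tau>" and "0 \<le> M"
    and y0: "\<And>i. 0 \<le> y i"
    and le: "\<And>k. 1 \<le> k \<Longrightarrow> k \<le> N \<Longrightarrow> y k * caputo_L1 \<alpha> \<tau> y k \<le> M * y k"
    and "1 \<le> n" "n \<le> N"
  shows "y n \<le> y 0 + \<tau> powr \<alpha> * Gamma (2 - \<alpha>) * M / b_coeff n (1 - \<alpha>)"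
  using \<open>1 \<le> n\<close> \<open>n \<le> N\<close>
proof (induction n rule: less_induct)
  case (less n)
  define b where "b = (\<lambda>j. b_coeff j (1 - \<alpha>))"
  define A where "A = \<tau> powr \<alpha> * Gamma (2 - \<alpha>) * M"
  have G: "0 < Gamma (2 - \<alpha>)"
    using \<alpha> by (intro Gamma_real_pos) simp
  have A: "0 \<le> A"
    using G \<open>0 \<le> M\<close> by (simp add: A_def)
  have b_pos: "0 < b j" if "1 \<le> j" for j
    using that \<alpha> by (simp add: b_def b_coeff_pos)
  have b_anti: "b j \<le> b i" if "1 \<le> i" "i \<le> j" for i j
    using that \<alpha> by (simp add: b_def b_coeff_antimono)
  obtain m where m: "n = Suc m"
    using less.prems by (cases n) auto
  show ?case
  proof (cases "y n = 0")
    case True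
    then show ?thesis
      using y0[of 0] A b_pos[of n] less.prems by (simp add: A_def b_def)
  next
    case False
    then have "0 < y n"
      using y0[of n] by simp
    with le[OF less.prems] have "caputo_L1 \<alpha> \<tau> y n \<le> M"
      by (simp add: mult.commute)
    then have "y n - b n * y 0 - (\<Sum>i<m. (b (m - i) - b (n - i)) * y (Suc i)) \<le> A"
      using G \<open>0 < \<tau>\<close> unfolding m caputo_L1_by_parts A_def b_def
      by (simp add: powr_minus field_simps)
    moreover have "(\<Sum>i<m. (b (m - i) - b (n - i)) * y (Suc i)) \<le>
        (\<Sum>i<m. (b (m - i) - b (n - i)) * (y 0 + A / b n))"
    proof (intro sum_mono mult_left_mono)
      fix i assume i: "i \<in> {..<m}"
      have "y (Suc i) \<le> y 0 + A / b (Suc i)"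
        using less.IH[of "Suc i"] i m less.prems by (simp add: A_def b_def)
      also have "A / b (Suc i) \<le> A / b n"
        using A b_anti[of "Suc i" n] b_pos[of n] i m by (intro divide_left_mono) (auto simp: b_pos)
      finally show "y (Suc i) \<le> y 0 + A / b n" by simp
      show "0 \<le> b (m - i) - b (n - i)"
        using b_anti[of "m - i" "n - i"] i m by simp
    qed
    \<comment> \<open>The coefficients telescope to \<open>b (n - m) - b n\<close>, and \<open>b 1 = 1\<close>.\<close>
    moreover have "(\<Sum>i<m. (b (m - i) - b (n - i)) * (y 0 + A / b n)) = (1 - b n) * (y 0 + A / b n)"
    proof -
      have "(\<Sum>i<m. b (m - i) - b (n - i)) = b (n - m) - b n"
        using sum_lessThan_telescope[of "\<lambda>i. b (n - i)" m] m by simp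
      then show ?thesis
        using m by (simp add: sum_distrib_right[symmetric]) (simp add: b_def b_coeff_def)
    qed
    moreover have "(1 - b n) * (y 0 + A / b n) = y 0 + A / b n - b n * y 0 - A"
      using b_pos[of n] less.prems by (simp add: field_simps)
    ultimately have "y n \<le> y 0 + A / b n"
      by linarith
    then show ?thesis
      by (simp add: A_def b_def)
  qed
qed

text \<open>The bound in terms of the weights turned into one in terms of time: \<open>1 / b n\<close> is at most of order
  \<open>n\<^sup>\<alpha>\<close>, which combines with \<open>\<tau>\<^sup>\<alpha>\<close> to the power \<open>\<alpha>\<close> of the time \<open>n \<tau>\<close>. This removes the dependence on
  the step size.\<close>

lemma caputo_L1_stability:
  assumes \<alpha>: "0 < \<alpha>" "\<alpha> < 1" and "0 < \<tau>" and "0 \<le> M"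
    and "\<And>i. 0 \<le> y i"
    and "\<And>k. 1 \<le> k \<Longrightarrow> k \<le> N \<Longrightarrow> y k * caputo_L1 \<alpha> \<tau> y k \<le> M * y k"
    and n: "1 \<le> n" "n \<le> N"
  shows "y n \<le> y 0 + Gamma (2 - \<alpha>) / (1 - \<alpha>) * (real n * \<tau>) powr \<alpha> * M"
proof -
  define B where "B = (1 - \<alpha>) * real n powr (-\<alpha>)"
  have "B \<le> b_coeff n (1 - \<alpha>)"
    using b_coeff_bounds(2)[of "1 - \<alpha>" n] \<alpha> n by (simp add: B_def)
  moreover have "0 < B"
    using \<alpha> n by (simp add: B_def)
  ultimately have "\<tau> powr \<alpha> * Gamma (2 - \<alpha>) * M / b_coeff n (1 - \<alpha>) \<le>
      \<tau> powr \<alpha> * Gamma (2 - \<alpha>) * M / B"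
    using \<alpha> \<open>0 \<le> M\<close> Gamma_real_pos[of "2 - \<alpha>"] by (intro divide_left_mono) auto
  also have "\<dots> = Gamma (2 - \<alpha>) / (1 - \<alpha>) * (real n * \<tau>) powr \<alpha> * M"
    using n \<open>0 < \<tau>\<close> \<alpha> by (simp add: B_def powr_minus powr_mult field_simps)
  finally show ?thesis
    using caputo_L1_stability_weights[OF assms] by linarith
qed

section \<open>The $L^2$ inner product\<close>

lemma L2_inner_integrable:
  fixes u v :: "'a::euclidean_space \<Rightarrow> real"
  assumes "u \<in> L2 \<Omega>" "v \<in> L2 \<Omega>"
  shows "integrable (lebesgue_on \<Omega>) (\<lambda>x. u x * v x)"
proof (rule Bochner_Integration.integrable_bound)
  show "integrable (lebesgue_on \<Omega>) (\<lambda>x. (u x)\<^sup>2 + (v x)\<^sup>2)"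
    using assms by (auto simp: L2_def)
  show "(\<lambda>x. u x * v x) \<in> borel_measurable (lebesgue_on \<Omega>)"
    using assms by (auto simp: L2_def)
  have "\<bar>a * b\<bar> \<le> a\<^sup>2 + b\<^sup>2" for a b :: real
    using sum_squares_bound[of "\<bar>a\<bar>" "\<bar>b\<bar>"] abs_ge_zero[of "a * b"]
    unfolding abs_mult power2_abs by linarith
  then show "AE x in lebesgue_on \<Omega>. norm (u x * v x) \<le> norm ((u x)\<^sup>2 + (v x)\<^sup>2)"
    by simp
qed

lemma L2_norm_nonneg: "0 \<le> L2_norm \<Omega> u"
  by (simp add: L2_norm_def L2_inner_def)

lemma L2_norm_power2: "(L2_norm \<Omega> u)\<^sup>2 = L2_inner \<Omega> u u"
  by (simp add: L2_norm_def L2_inner_def)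

text \<open>The quadratic form \<open>\<parallel>s u - t v\<parallel>\<^sup>2\<close> in \<open>(s, t)\<close> is nonnegative, so its discriminant is not positive.\<close>

lemma L2_Cauchy_Schwarz:
  fixes u v :: "'a::euclidean_space \<Rightarrow> real"
  assumes u: "u \<in> L2 \<Omega>" and v: "v \<in> L2 \<Omega>"
  shows "L2_inner \<Omega> u v \<le> L2_norm \<Omega> u * L2_norm \<Omega> v"
proof -
  define p q r where "p = L2_inner \<Omega> u u" and "q = L2_inner \<Omega> u v" and "r = L2_inner \<Omega> v v"
  have "0 \<le> s\<^sup>2 * p - 2 * s * t * q + t\<^sup>2 * r" for s t
  proof -
    have "0 \<le> (\<integral>x. (s * u x - t * v x)\<^sup>2 \<partial>lebesgue_on \<Omega>)"
      by simp
    also have "\<dots> = (\<integral>x. s\<^sup>2 * (u x * u x) - 2 * s * t * (u x * v x) + t\<^sup>2 * (v x * v x) \<partial>lebesgue_on \<Omega>)"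
      by (rule Bochner_Integration.integral_cong) (simp_all add: power2_eq_square algebra_simps)
    also have "\<dots> = s\<^sup>2 * p - 2 * s * t * q + t\<^sup>2 * r"
      using L2_inner_integrable[OF u u] L2_inner_integrable[OF u v] L2_inner_integrable[OF v v]
      by (simp add: p_def q_def r_def L2_inner_def)
    finally show ?thesis .
  qed
  note quad = this
  have pr: "0 \<le> p" "0 \<le> r"
    by (simp_all add: p_def r_def L2_inner_def)
  have "q\<^sup>2 \<le> p * r"
  proof (cases "r = 0")
    case True
    have "q = 0"
    proof (rule ccontr)
      assume "q \<noteq> 0"
      \<comment> \<open>With \<open>r = 0\<close> the form is affine in \<open>t\<close>; this \<open>t\<close> gives it the value \<open>-1\<close>.\<close>
      with quad[of 1 "(p + 1) / (2 * q)"] True show False by simp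
    qed
    then show ?thesis
      using pr by simp
  next
    case False
    have "0 \<le> r * (p * r - q\<^sup>2)"
      using quad[of r q] by (simp add: power2_eq_square algebra_simps)
    with False pr show ?thesis
      by (simp add: zero_le_mult_iff)
  qed
  then have "\<bar>q\<bar> \<le> sqrt (p * r)"
    by (metis real_sqrt_abs real_sqrt_le_iff)
  then show ?thesis
    by (simp add: p_def q_def r_def L2_norm_def real_sqrt_mult)
qed

lemma L2_inner_bounded_left:
  fixes v :: "'a::euclidean_space \<Rightarrow> real"
  assumes \<Omega>: "\<Omega> \<in> lmeasurable" and v: "v \<in> L2 \<Omega>"
    and g: "\<And>x. x \<in> \<Omega> \<Longrightarrow> \<bar>g x\<bar> \<le> F" and "0 \<le> F"
  shows "L2_inner \<Omega> g v \<le> F * sqrt (measure lebesgue \<Omega>) * L2_norm \<Omega> v"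
proof (cases "integrable (lebesgue_on \<Omega>) (\<lambda>x. g x * v x)")
  case False
  \<comment> \<open>The integral is then zero by convention.\<close>
  then show ?thesis
    using \<open>0 \<le> F\<close> by (simp add: L2_inner_def not_integrable_integral_eq L2_norm_nonneg)
next
  case True
  interpret finite_measure "lebesgue_on \<Omega>"
    using \<Omega> by (simp add: finite_measure_lebesgue_on)
  have one: "(\<lambda>x. 1) \<in> L2 \<Omega>" and av: "(\<lambda>x. \<bar>v x\<bar>) \<in> L2 \<Omega>"
    using v by (auto simp: L2_def)
  have "L2_inner \<Omega> g v \<le> F * L2_inner \<Omega> (\<lambda>x. 1) (\<lambda>x. \<bar>v x\<bar>)"
    unfolding L2_inner_def Bochner_Integration.integral_mult_right_zero[symmetric]
  proof (rule integral_mono)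
    show "integrable (lebesgue_on \<Omega>) (\<lambda>x. F * (1 * \<bar>v x\<bar>))"
      using L2_inner_integrable[OF one av] by simp
    fix x assume "x \<in> space (lebesgue_on \<Omega>)"
    then have "\<bar>g x\<bar> * \<bar>v x\<bar> \<le> F * \<bar>v x\<bar>"
      using g by (simp add: mult_right_mono)
    then show "g x * v x \<le> F * (1 * \<bar>v x\<bar>)"
      using abs_ge_self[of "g x * v x"] by (simp add: abs_mult)
  qed (fact True)
  also have "\<dots> \<le> F * (L2_norm \<Omega> (\<lambda>x. 1) * L2_norm \<Omega> (\<lambda>x. \<bar>v x\<bar>))"
    using L2_Cauchy_Schwarz[OF one av] \<open>0 \<le> F\<close> by (rule mult_left_mono)
  also have "L2_norm \<Omega> (\<lambda>x. 1) = sqrt (measure lebesgue \<Omega>)"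
    using \<Omega> by (simp add: L2_norm_def L2_inner_def measure_restrict_space fmeasurableD)
  also have "L2_norm \<Omega> (\<lambda>x. \<bar>v x\<bar>) = L2_norm \<Omega> v"
    by (simp add: L2_norm_def L2_inner_def)
  finally show ?thesis
    by simp
qed

lemma L2_inner_caputo_L1:
  fixes v :: "'a::euclidean_space \<Rightarrow> real"
  assumes u: "\<And>i. i \<le> n \<Longrightarrow> u i \<in> L2 \<Omega>" and v: "v \<in> L2 \<Omega>"
  shows "L2_inner \<Omega> (\<lambda>x. caputo_L1 \<alpha> \<tau> (\<lambda>i. u i x) n) v =
    caputo_L1 \<alpha> \<tau> (\<lambda>i. L2_inner \<Omega> (u i) v) n"
proof -
  define c where "c = \<tau> powr (-\<alpha>) / Gamma (2 - \<alpha>)"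
  have int: "integrable (lebesgue_on \<Omega>) (\<lambda>x. u i x * v x)" if "i \<le> n" for i
    using L2_inner_integrable[OF u[OF that] v] .
  have "L2_inner \<Omega> (\<lambda>x. caputo_L1 \<alpha> \<tau> (\<lambda>i. u i x) n) v =
    (\<integral>x. c * (\<Sum>i<n. b_coeff (n - i) (1 - \<alpha>) * (u (Suc i) x * v x - u i x * v x)) \<partial>lebesgue_on \<Omega>)"
    unfolding L2_inner_def caputo_L1_def c_def
    by (intro Bochner_Integration.integral_cong)
      (simp_all add: sum_distrib_left sum_distrib_right algebra_simps)
  also have "\<dots> = c * (\<Sum>i<n. \<integral>x. b_coeff (n - i) (1 - \<alpha>) * (u (Suc i) x * v x - u i x * v x) \<partial>lebesgue_on \<Omega>)"
    using int by (subst Bochner_Integration.integral_mult_right_zero, subst Bochner_Integration.integral_sum) auto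
  also have "\<dots> = c * (\<Sum>i<n. b_coeff (n - i) (1 - \<alpha>) * (L2_inner \<Omega> (u (Suc i)) v - L2_inner \<Omega> (u i) v))"
    using int by (intro arg_cong2[where f = "(*)"] sum.cong) (simp_all add: L2_inner_def)
  finally show ?thesis
    by (simp add: caputo_L1_def c_def)
qed

text \<open>The discrete counterpart of \<open>\<parallel>u\<parallel> \<parallel>u\<parallel>' = (u', u)\<close>, with an inequality because of the memory. The
  sequence \<open>(u i, u n) - \<parallel>u n\<parallel> \<parallel>u i\<parallel>\<close> is nonpositive by the Cauchy--Schwarz inequality and vanishes at
  \<open>i = n\<close>, so the discrete maximum principle applies to it.\<close>

lemma L2_norm_caputo_L1_le:
  fixes u :: "nat \<Rightarrow> 'a::euclidean_space \<Rightarrow> real"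
  assumes \<alpha>: "0 < \<alpha>" "\<alpha> < 1" and u: "\<And>i. i \<le> n \<Longrightarrow> u i \<in> L2 \<Omega>"
  shows "L2_norm \<Omega> (u n) * caputo_L1 \<alpha> \<tau> (\<lambda>i. L2_norm \<Omega> (u i)) n \<le>
    L2_inner \<Omega> (\<lambda>x. caputo_L1 \<alpha> \<tau> (\<lambda>i. u i x) n) (u n)"
proof -
  have "0 \<le> caputo_L1 \<alpha> \<tau> (\<lambda>i. L2_inner \<Omega> (u i) (u n) - L2_norm \<Omega> (u n) * L2_norm \<Omega> (u i)) n"
    using \<alpha> u L2_Cauchy_Schwarz[OF u u[OF order_refl]]
    by (intro caputo_L1_nonneg_at_max)
      (simp_all add: L2_norm_power2[symmetric] power2_eq_square mult.commute)
  then show ?thesis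
    using u by (simp add: caputo_L1_diff_scale L2_inner_caputo_L1)
qed

section \<open>Stability of the scheme\<close>

lemma fem_space_subset_L2: "fem_space \<Omega> \<T> \<subseteq> L2 \<Omega>"
  by (auto simp: fem_space_def sobolev1_zero_def sobolev_def)

lemma diffusion_form_nonneg:
  assumes "\<And>x. x \<in> \<Omega> \<Longrightarrow> 0 \<le> w x"
  shows "0 \<le> diffusion_form \<Omega> w u u"
  unfolding diffusion_form_def using assms by (intro Bochner_Integration.integral_nonneg) simp

text \<open>The scheme tested with \<open>v = u n\<close>. The source is bounded uniformly in its last
  argument, so the implicit first step and the extrapolated later ones are covered alike.\<close>

lemma scheme_energy_inequality:
  fixes \<Omega> :: "'a::euclidean_space set"
  assumes "0 < \<alpha>" "\<alpha> < 1" "0 \<le> T" "\<Omega> \<in> lmeasurable"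
    and f: "source_condition \<Omega> T F L f"
    and D: "diffusion_condition \<Omega> T Dmin Dmax \<kappa> D"
    and scheme: "scheme_solution \<alpha> T \<Omega> D f \<phi> \<T> N u"
    and n: "1 \<le> n" "n \<le> N"
  shows "L2_norm \<Omega> (u n) * caputo_L1 \<alpha> (T / real N) (\<lambda>i. L2_norm \<Omega> (u i)) n \<le>
    F * sqrt (measure lebesgue \<Omega>) * L2_norm \<Omega> (u n)"
proof -
  define \<tau> where "\<tau> = T / real N"
  have u: "u i \<in> fem_space \<Omega> \<T>" if "i \<le> N" for i
    using scheme that by (simp add: scheme_solution_def Let_def)
  have uL2: "u i \<in> L2 \<Omega>" if "i \<le> N" for i
    using u[OF that] fem_space_subset_L2 by blast
  have tn: "real n * \<tau> \<in> {0..T}"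
    using n \<open>0 \<le> T\<close> by (simp add: \<tau>_def field_simps mult_left_mono)
  have "L2_norm \<Omega> (u n) * caputo_L1 \<alpha> \<tau> (\<lambda>i. L2_norm \<Omega> (u i)) n \<le>
      L2_inner \<Omega> (\<lambda>x. caputo_L1 \<alpha> \<tau> (\<lambda>i. u i x) n) (u n)"
    using assms uL2 by (intro L2_norm_caputo_L1_le) auto
  also have "\<dots> \<le> L2_inner \<Omega> (\<lambda>x. caputo_L1 \<alpha> \<tau> (\<lambda>i. u i x) n) (u n) +
      diffusion_form \<Omega> (\<lambda>x. D x (real n * \<tau>)) (u n) (u n)"
  proof -
    have "0 \<le> D x (real n * \<tau>)" if "x \<in> \<Omega>" for x
      using D tn that unfolding diffusion_condition_def by (meson less_le_trans less_imp_le)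
    then show ?thesis
      by (simp add: diffusion_form_nonneg)
  qed
  also have "\<dots> = L2_inner \<Omega> (\<lambda>x. f x (real n * \<tau>) (extrapolation u n x)) (u n)"
    using scheme n u[of n] unfolding scheme_solution_def \<tau>_def Let_def by auto
  also have "\<dots> \<le> F * sqrt (measure lebesgue \<Omega>) * L2_norm \<Omega> (u n)"
    using f tn uL2[of n] n assms(4)
    by (intro L2_inner_bounded_left) (auto simp: source_condition_def)
  finally show ?thesis
    by (simp add: \<tau>_def)
qed

theorem theorem1:
  fixes \<alpha> T :: real and \<Omega> :: "'a::euclidean_space set"
  assumes "0 < \<alpha>" "\<alpha> < 1" and "0 < T"
    and "open \<Omega>" "connected \<Omega>" "\<Omega> \<noteq> {}" "bounded \<Omega>"
  shows "\<exists>C>0. \<forall>p F L Dmin Dmax \<kappa> D f \<phi> \<rho> h \<T> N u.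
           0 < p \<and> p \<le> 2 \<and> \<phi> \<in> sobolev_zero p \<Omega> \<and>
           source_condition \<Omega> T F L f \<and>
           diffusion_condition \<Omega> T Dmin Dmax \<kappa> D \<and>
           quasiuniform_triangulation \<Omega> \<rho> h \<T> \<and>
           scheme_solution \<alpha> T \<Omega> D f \<phi> \<T> N u \<longrightarrow>
           (\<forall>n\<in>{1..N}. L2_norm \<Omega> (u n) \<le> C * (L2_norm \<Omega> (u 0) + F))"
proof -
  define K where "K = Gamma (2 - \<alpha>) / (1 - \<alpha>) * T powr \<alpha> * sqrt (measure lebesgue \<Omega>)"
  have G: "0 < Gamma (2 - \<alpha>)"
    using assms by (intro Gamma_real_pos) simp
  have K: "0 \<le> K"
    using assms G by (simp add: K_def)
  have \<Omega>: "\<Omega> \<in> lmeasurable"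
    using assms by (intro bounded_set_imp_lmeasurable) (auto intro: borel_open)
  have bound: "L2_norm \<Omega> (u n) \<le> (1 + K) * (L2_norm \<Omega> (u 0) + F)"
    if f: "source_condition \<Omega> T F L f" and D: "diffusion_condition \<Omega> T Dmin Dmax \<kappa> D"
      and scheme: "scheme_solution \<alpha> T \<Omega> D f \<phi> \<T> N u" and n: "n \<in> {1..N}"
    for F L Dmin Dmax \<kappa> D f \<phi> \<T> N u n
  proof -
    define M where "M = F * sqrt (measure lebesgue \<Omega>)"
    have F: "0 < F"
      using f by (simp add: source_condition_def)
    have "L2_norm \<Omega> (u n) \<le> L2_norm \<Omega> (u 0) +
        Gamma (2 - \<alpha>) / (1 - \<alpha>) * (real n * (T / real N)) powr \<alpha> * M"
    proof (rule caputo_L1_stability[where N = N])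
      show "L2_norm \<Omega> (u k) * caputo_L1 \<alpha> (T / real N) (\<lambda>i. L2_norm \<Omega> (u i)) k \<le>
          M * L2_norm \<Omega> (u k)" if "1 \<le> k" "k \<le> N" for k
        unfolding M_def using assms that
        by (intro scheme_energy_inequality[OF _ _ _ \<Omega> f D scheme]) auto
    qed (use assms n F in \<open>auto simp: M_def L2_norm_nonneg\<close>)
    also have "Gamma (2 - \<alpha>) / (1 - \<alpha>) * (real n * (T / real N)) powr \<alpha> * M \<le>
        Gamma (2 - \<alpha>) / (1 - \<alpha>) * T powr \<alpha> * M"
    proof (intro mult_right_mono mult_left_mono powr_mono2)
      show "real n * (T / real N) \<le> T"
        using n assms by (simp add: field_simps mult_left_mono)
    qed (use assms n F G in \<open>auto simp: M_def\<close>)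
    also have "\<dots> = K * F"
      by (simp add: K_def M_def)
    also have "L2_norm \<Omega> (u 0) + K * F \<le> (1 + K) * (L2_norm \<Omega> (u 0) + F)"
      using K F L2_norm_nonneg[of \<Omega> "u 0"] by (simp add: algebra_simps)
    finally show ?thesis
      by simp
  qed
  show ?thesis
  proof (intro exI[of _ "1 + K"] conjI)
    show "0 < 1 + K"
      using K by simp
  qed (use bound in blast)
qed

end
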